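(* Let $n\ge 3$ be an integer and let $a,b\in\mathbb{R}$ with $b\neq 0$. The circulant matrix $\mathrm{Circ}(a,b,0,\ldots,0,b)\in\mathcal{M}_n(\mathbb{R})$ (first row: $a$, then $b$, then $n-3$ zeros, then $b$) is invertible if and only if $$\prod_{j=0}^{\lceil\frac{n-1}{2}\rceil}\Big[a+2b\cos\Big(\frac{2\pi j}{n}\Big)\Big]\neq 0,$$ and in this case $\mathrm{Circ}(a,b,0,\ldots,0,b)^{-1}=\mathrm{Circ}(g_1,\ldots,g_n)$, where $$g_j=\frac{(-1)^j}{2b\big[1-(-1)^nT_n\big(\frac{a}{2b}\big)\big]}\Big[U_{j-2}\Big(\frac{a}{2b}\Big)+(-1)^{n}U_{n-j}\Big(\frac{a}{2b}\Big)\Big],\qquad j=1,\ldots,n.$$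
   Context: For $(a_1,\ldots,a_n)\in\mathbb{R}^n$, $\mathrm{Circ}(a_1,\ldots,a_n)\in\mathcal{M}_n(\mathbb{R})$ denotes the circulant matrix whose $(i,j)$ entry is $a_{1+((j-i)\bmod n)}$; its first row is $(a_1,\ldots,a_n)$ and each row is the cyclic right shift of the previous one. $\{T_m\}_{m\in\mathbb{Z}}$ and $\{U_m\}_{m\in\mathbb{Z}}$ are the Chebyshev polynomials of the first and second kind: both satisfy $Q_{m+1}(x)=2xQ_m(x)-Q_{m-1}(x)$ for all $m\in\mathbb{Z}$, with $T_0(x)=U_0(x)=1$, $T_1(x)=x$, $U_1(x)=2x$. In particular $U_{-1}(x)=0$. *)

theory Defs
  imports Complex_Main "HOL-Computational_Algebra.Polynomial" "Jordan_Normal_Form.Matrix"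
begin

text \<open>\<open>circ [a\<^sub>1, \<dots>, a\<^sub>n]\<close> is \<open>Circ(a\<^sub>1, \<dots>, a\<^sub>n)\<close>. Matrix and list indices both start at 0, so the entry
  \<open>a\<^bsub>1 + ((j - i) mod n)\<^esub>\<close> is list element \<open>(j - i) mod n\<close>; the difference is taken in \<open>int\<close>
  because it may be negative.\<close>

definition circ :: "'a list \<Rightarrow> 'a mat" where
  "circ xs = mat (length xs) (length xs)
     (\<lambda>(i, j). xs ! nat ((int j - int i) mod int (length xs)))"

text \<open>Sequences with \<open>Q (m + 1) = 2 x Q m - Q (m - 1)\<close>, first for \<open>m \<ge> 0\<close> and then for all integers:
  the recurrence is symmetric under \<open>m \<mapsto> - m\<close>, so the negative half is the same recursion started
  from \<open>Q 0\<close> and \<open>Q (- 1) = 2 x Q 0 - Q 1\<close>.\<close>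

fun cheb_nat :: "real poly \<Rightarrow> real poly \<Rightarrow> nat \<Rightarrow> real poly" where
  "cheb_nat p q 0 = p"
| "cheb_nat p q (Suc 0) = q"
| "cheb_nat p q (Suc (Suc m)) = [:0, 2:] * cheb_nat p q (Suc m) - cheb_nat p q m"

definition cheb :: "real poly \<Rightarrow> real poly \<Rightarrow> int \<Rightarrow> real poly" where
  "cheb p q m =
     (if 0 \<le> m then cheb_nat p q (nat m) else cheb_nat p ([:0, 2:] * p - q) (nat (- m)))"

definition cheb_T :: "int \<Rightarrow> real poly" where
  "cheb_T = cheb 1 [:0, 1:]"

definition cheb_U :: "int \<Rightarrow> real poly" where
  "cheb_U = cheb 1 [:0, 2:]"

lemma cheb_rec: "cheb p q (m + 1) = [:0, 2:] * cheb p q m - cheb p q (m - 1)"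
proof -
  consider k where "m = int (Suc k)" | "m = 0" | "m = - 1" | k where "m = - int (Suc (Suc k))"
  proof (cases m)
    case (nonneg n)
    then show ?thesis using that by (cases n) auto
  next
    case (neg n)
    then show ?thesis using that by (cases n) auto
  qed
  then show ?thesis
  proof cases
    case (1 k)
    then have "nat (m + 1) = Suc (Suc k)" "nat m = Suc k" "nat (m - 1) = k" by auto
    then show ?thesis using 1 by (simp add: cheb_def)
  next
    case 2
    then show ?thesis by (simp add: cheb_def)
  next
    case 3
    have "nat (- (m - 1)) = Suc (Suc 0)" using 3 by simp
    with 3 show ?thesis by (simp add: cheb_def numeral_2_eq_2)
  next
    case (4 k)
    then have "nat (- (m + 1)) = Suc k" "nat (- m) = Suc (Suc k)"
      "nat (- (m - 1)) = Suc (Suc (Suc k))" by auto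
    then show ?thesis using 4 by (simp add: cheb_def del: minus_diff_eq minus_add_distrib)
  qed
qed

lemma cheb_T_rec: "cheb_T (m + 1) = [:0, 2:] * cheb_T m - cheb_T (m - 1)"
  by (simp add: cheb_T_def cheb_rec)

lemma cheb_U_rec: "cheb_U (m + 1) = [:0, 2:] * cheb_U m - cheb_U (m - 1)"
  by (simp add: cheb_U_def cheb_rec)

lemma cheb_initial:
  "cheb_T 0 = 1" "cheb_T 1 = [:0, 1:]" "cheb_U 0 = 1" "cheb_U 1 = [:0, 2:]" "cheb_U (- 1) = 0"
  by (simp_all add: cheb_T_def cheb_U_def cheb_def)

end

theory Submission
  imports Defs "Jordan_Normal_Form.Determinant"
begin

text \<open>
  Put \<open>A = Circ(a, b, 0, \<dots>, 0, b)\<close> and \<open>x = a / (2 b)\<close>. On sequences of period \<open>n\<close>, the matrix \<open>A\<close>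
  acts as the difference operator \<open>f \<mapsto> b f (i - 1) + a f i + b f (i + 1)\<close>, so both halves of the
  claim concern the recurrence \<open>f (i + 1) = - 2 x f i - f (i - 1)\<close>, that is, the Chebyshev
  recurrence with alternating signs.

  If some factor \<open>a + 2 b cos \<theta>\<close> with \<open>\<theta> = 2 \<pi> j / n\<close> vanishes, then the periodic sequence \<open>cos (k \<theta>)\<close>
  is a nonzero element of the kernel, and \<open>A\<close> is singular (\<open>circ_tridiagonal_kernel\<close>).

  If no factor vanishes, then \<open>T\<^sub>n(x) \<noteq> (- 1)\<^sup>n\<close>. Indeed, \<open>\<bar>T\<^sub>n\<bar> > 1\<close> outside \<open>[- 1, 1]\<close>,
  and for \<open>x = - cos \<theta>\<close> the equation \<open>T\<^sub>n(x) = (- 1)\<^sup>n\<close> says \<open>cos (n \<theta>) = 1\<close>, which makes \<open>\<theta>\<close> one of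
  the angles in the product (\<open>cheb_T_eq_sign_imp\<close>). The numbers \<open>g\<^sub>j\<close> are therefore given by a formula
  with a nonzero denominator. They are the discrete Green's function of the operator: read for all
  indices \<open>j \<ge> 0\<close>, the formula solves the homogeneous recurrence and satisfies \<open>g\<^bsub>n+1\<^esub> = g\<^sub>1\<close>, while
  \<open>b (g\<^sub>n - g\<^sub>0) = 1\<close>. The last defect of periodicity is exactly what turns the zero on the diagonal
  of \<open>A Circ(g\<^sub>1, \<dots>, g\<^sub>n)\<close> into a one (\<open>circ_tridiagonal_mult_eq_one\<close>). A one-sided inverse of a square
  matrix over a field is two-sided.
\<close>

section \<open>Products with a circulant matrix\<close>

lemma circ_carrier: "circ xs \<in> carrier_mat (length xs) (length xs)"
  by (simp add: circ_def)

lemma circ_index: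
  "i < length xs \<Longrightarrow> k < length xs \<Longrightarrow>
     circ xs $$ (i, k) = xs ! nat ((int k - int i) mod int (length xs))"
  by (simp add: circ_def)

text \<open>Indexing the columns by their cyclic offset \<open>d\<close> from the diagonal makes the coefficients
  independent of the row, so that the zeros of the first row can be dropped from the sum.\<close>

lemma circ_row_sum:
  fixes xs :: "'a :: comm_ring_1 list"
  assumes i: "i < length xs"
  shows "(\<Sum>k<length xs. circ xs $$ (i, k) * f k) =
         (\<Sum>d<length xs. xs ! d * f ((i + d) mod length xs))"
proof -
  let ?n = "length xs"
  have n: "?n > 0" using i by linarith
  have offset: "nat ((int ((i + d) mod ?n) - int i) mod int ?n) = d" if "d < ?n" for d
  proof -
    have "(int ((i + d) mod ?n) - int i) mod int ?n = (int (i + d) - int i) mod int ?n"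
      unfolding zmod_int by (simp add: mod_diff_left_eq)
    then show ?thesis using that by simp
  qed
  have column: "(i + nat ((int k - int i) mod int ?n)) mod ?n = k" if "k < ?n" for k
  proof -
    have "int ((i + nat ((int k - int i) mod int ?n)) mod ?n)
        = (int i + (int k - int i) mod int ?n) mod int ?n"
      using n by (simp add: zmod_int)
    also have "\<dots> = int k" using that by (simp add: mod_add_right_eq)
    finally show ?thesis by linarith
  qed
  show ?thesis
  proof (rule sum.reindex_bij_witness[where i = "\<lambda>d. (i + d) mod ?n"
        and j = "\<lambda>k. nat ((int k - int i) mod int ?n)"])
    fix k assume k: "k \<in> {..<?n}"
    show "(i + nat ((int k - int i) mod int ?n)) mod ?n = k" using column k by simp
    show "nat ((int k - int i) mod int ?n) \<in> {..<?n}" using n by (simp add: nat_less_iff)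
    show "xs ! nat ((int k - int i) mod int ?n) * f ((i + nat ((int k - int i) mod int ?n)) mod ?n)
        = circ xs $$ (i, k) * f k"
      using column k i by (simp add: circ_index)
  next
    fix d assume d: "d \<in> {..<?n}"
    show "nat ((int ((i + d) mod ?n) - int i) mod int ?n) = d" using offset d by simp
    show "(i + d) mod ?n \<in> {..<?n}" using n by simp
  qed
qed

lemma circ_tridiagonal_row_sum:
  fixes a b :: "'a :: comm_ring_1"
  assumes n: "n \<ge> 3" and i: "i < n"
  defines "A \<equiv> circ ([a, b] @ replicate (n - 3) 0 @ [b])"
  shows "(\<Sum>k<n. A $$ (i, k) * f k) =
         a * f i + b * f ((i + 1) mod n) + b * f ((i + (n - 1)) mod n)"
proof -
  let ?xs = "[a, b] @ replicate (n - 3) 0 @ [b]"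
  let ?t = "\<lambda>d. ?xs ! d * f ((i + d) mod n)"
  have len: "length ?xs = n" using n by simp
  have nth: "?xs ! 0 = a" "?xs ! 1 = b" "?xs ! (n - 1) = b"
    "\<And>d. 2 \<le> d \<Longrightarrow> d < n - 1 \<Longrightarrow> ?xs ! d = 0"
    using n by (auto simp: nth_append nth_Cons' simp flip: One_nat_def)
  have "(\<Sum>k<n. A $$ (i, k) * f k) = (\<Sum>d<n. ?t d)"
    using circ_row_sum[of i ?xs f] i unfolding A_def len by simp
  also have "\<dots> = (\<Sum>d\<in>{0, 1, n - 1}. ?t d)"
  proof (rule sum.mono_neutral_right)
    show "\<forall>d\<in>{..<n} - {0, 1, n - 1}. ?t d = 0"
    proof
      fix d assume "d \<in> {..<n} - {0, 1, n - 1}"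
      then have "2 \<le> d" "d < n - 1" by auto
      then show "?t d = 0" using nth(4)[of d] by simp
    qed
  qed (use n in auto)
  also have "\<dots> = ?t 0 + ?t 1 + ?t (n - 1)"
    using n by (simp add: add.assoc)
  finally show ?thesis using i by (simp only: nth) simp
qed

text \<open>The entry \<open>(i, j)\<close> of the product depends only on \<open>e = (j - i) mod n\<close> and combines the values of
  \<open>g\<close> at \<open>e\<close>, \<open>e + 1\<close> and \<open>e + 2\<close>, the outer two being moved into the range \<open>1, \<dots>, n\<close> cyclically.
  Off the diagonal the recurrence makes it zero: nothing wraps around for \<open>0 < e < n - 1\<close>, and for
  \<open>e = n - 1\<close> only \<open>g (n + 1)\<close> is replaced by its equal \<open>g 1\<close>. On the diagonal \<open>g 0\<close> is replaced by \<open>g n\<close>,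
  which adds \<open>b * (g n - g 0) = 1\<close> to the zero of the recurrence.\<close>

lemma circ_tridiagonal_mult_eq_one:
  fixes a b :: "'a :: comm_ring_1"
  assumes n: "n \<ge> 3"
    and rec: "\<And>j. b * g j + a * g (j + 1) + b * g (j + 2) = 0"
    and periodic: "g (n + 1) = g 1"
    and jump: "b * (g n - g 0) = 1"
  shows "circ ([a, b] @ replicate (n - 3) 0 @ [b]) * circ (map g [1..<Suc n]) = 1\<^sub>m n"
    (is "?A * ?G = _")
proof (rule eq_matI)
  let ?xs = "[a, b] @ replicate (n - 3) 0 @ [b]"
  have len: "length ?xs = n" using n by simp
  have A: "?A \<in> carrier_mat n n" using circ_carrier[of ?xs] by (simp only: len)
  have G: "?G \<in> carrier_mat n n" using circ_carrier[of "map g [1..<Suc n]"] by (simp del: upt_Suc)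
  show "dim_row (?A * ?G) = dim_row (1\<^sub>m n)" "dim_col (?A * ?G) = dim_col (1\<^sub>m n)"
    using A G by auto
  fix i j assume "i < dim_row (1\<^sub>m n :: 'a mat)" "j < dim_col (1\<^sub>m n :: 'a mat)"
  then have i: "i < n" and j: "j < n" by auto
  have n0: "n > 0" using n by simp
  define e where "e = nat ((int j - int i) mod int n)"
  have e: "e < n" using n0 by (simp add: e_def nat_less_iff)
  have inte: "int e = (int j - int i) mod int n" using n0 by (simp add: e_def)
  have Gent: "?G $$ ((i + d) mod n, j) = g (Suc (nat ((int e - int d) mod int n)))" for d
  proof -
    have "(int j - int ((i + d) mod n)) mod int n = (int j - int (i + d)) mod int n"
      by (simp only: zmod_int mod_diff_right_eq)
    also have "\<dots> = (int e - int d) mod int n"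
      unfolding inte by (simp add: mod_diff_left_eq algebra_simps)
    finally have "?G $$ ((i + d) mod n, j) = map g [1..<Suc n] ! nat ((int e - int d) mod int n)"
      using circ_index[of "(i + d) mod n" "map g [1..<Suc n]" j] n0 j by simp
    moreover have "nat ((int e - int d) mod int n) < n" using n0 by (simp add: nat_less_iff)
    ultimately show ?thesis by (simp del: upt_Suc)
  qed
  have "(?A * ?G) $$ (i, j) = (\<Sum>k<n. ?A $$ (i, k) * ?G $$ (k, j))"
    using A G i j by (simp add: scalar_prod_def atLeast0LessThan)
  also have "\<dots> = a * ?G $$ ((i + 0) mod n, j) + b * ?G $$ ((i + 1) mod n, j)
                 + b * ?G $$ ((i + (n - 1)) mod n, j)"
    using circ_tridiagonal_row_sum[OF n i, of a b "\<lambda>k. ?G $$ (k, j)"] i by simp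
  also have "\<dots> = a * g (Suc e) + b * g (Suc (nat ((int e - 1) mod int n)))
                 + b * g (Suc (nat ((int e + 1) mod int n)))"
  proof -
    have "(int e - int (n - 1)) mod int n = (int e + 1 - int n) mod int n"
      using n by (simp add: of_nat_diff algebra_simps)
    then have *: "(int e - int (n - 1)) mod int n = (int e + 1) mod int n"
      by simp
    \<comment> \<open>The offsets \<open>1\<close> and \<open>n - 1\<close> of the entries \<open>b\<close> lower and raise \<open>e\<close> by one.\<close>
    show ?thesis unfolding Gent * using e by simp
  qed
  also have "\<dots> = (if e = 0 then 1 else 0)"
  proof -
    consider "e = 0" | "0 < e" "e = n - 1" | "0 < e" "e < n - 1" using e by linarith
    then show ?thesis
    proof cases
      case 1
      have "(- 1) mod int n = int n - 1" using n by (simp add: zmod_minus1)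
      then have "nat ((- 1) mod int n) = n - 1" by linarith
      then show ?thesis using 1 n rec[of 0] jump by (simp add: algebra_simps eval_nat_numeral)
    next
      case 2
      then have ne: "n = Suc e" using n by simp
      have "(int e - 1) mod int n = int e - 1" using e 2(1) by simp
      then have "Suc (nat ((int e - 1) mod int n)) = e" using 2(1) by linarith
      moreover have "nat ((int e + 1) mod int n) = 0" unfolding ne by (simp add: add.commute)
      moreover have "g (e + 2) = g (Suc 0)" using periodic unfolding ne by simp
      ultimately show ?thesis using 2(1) rec[of e] by (simp add: add.commute add.left_commute)
    next
      case 3
      have "(int e - 1) mod int n = int e - 1" "(int e + 1) mod int n = int e + 1" using e 3 by auto
      then have "nat ((int e - 1) mod int n) = e - 1" "nat ((int e + 1) mod int n) = e + 1" by linarith+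
      then show ?thesis using 3 rec[of e] by (simp add: algebra_simps)
    qed
  qed
  also have "e = 0 \<longleftrightarrow> i = j"
  proof
    assume "e = 0"
    then have "(int j - int i) mod int n = 0" using inte by simp
    then have "int j mod int n = int i mod int n" by (simp add: mod_eq_dvd_iff dvd_eq_mod_eq_0)
    then show "i = j" using i j by simp
  qed (simp add: e_def)
  finally show "(?A * ?G) $$ (i, j) = 1\<^sub>m n $$ (i, j)" using i j by simp
qed

text \<open>The vector \<open>cos (k \<theta>)\<close> is an eigenvector because \<open>cos ((k + 1) \<theta>) + cos ((k - 1) \<theta>) = 2 cos \<theta> cos (k \<theta>)\<close>,
  also across the boundary since \<open>n \<theta>\<close> is a multiple of \<open>2 \<pi>\<close>. It is the real part of the usual
  complex eigenvector of a circulant matrix.\<close>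

lemma circ_tridiagonal_kernel:
  fixes a b :: real
  assumes n: "n \<ge> 3" and j: "a + 2 * b * cos (2 * pi * real j / real n) = 0"
  shows "\<not> invertible_mat (circ ([a, b] @ replicate (n - 3) 0 @ [b]))" (is "\<not> invertible_mat ?A")
proof
  let ?xs = "[a, b] @ replicate (n - 3) 0 @ [b]"
  define \<theta> where "\<theta> = 2 * pi * real j / real n"
  define v where "v = vec n (\<lambda>k. cos (real k * \<theta>))"
  have len: "length ?xs = n" using n by simp
  have A: "?A \<in> carrier_mat n n" using circ_carrier[of ?xs] by (simp only: len)
  have n0: "n > 0" using n by simp
  have n\<theta>: "real n * \<theta> = 2 * real j * pi" using n0 by (simp add: \<theta>_def)
  have cos_mod: "cos (real (k mod n) * \<theta>) = cos (real k * \<theta>)" for k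
  proof -
    have "real k * \<theta> = real (k mod n) * \<theta> + real (n * (k div n)) * \<theta>"
      by (metis distrib_right mod_mult_div_eq of_nat_add)
    also have "real (n * (k div n)) * \<theta> = 2 * real (k div n * j) * pi"
      using n0 by (simp add: \<theta>_def)
    also have "cos (real (k mod n) * \<theta> + 2 * real (k div n * j) * pi) = cos (real (k mod n) * \<theta>)"
      by (simp only: cos_add cos_2npi sin_2npi mult_1_right mult_zero_right diff_zero)
    finally show ?thesis by simp
  qed
  have Av: "?A *\<^sub>v v = 0\<^sub>v n"
  proof (rule eq_vecI)
    fix i assume "i < dim_vec (0\<^sub>v n :: real vec)"
    then have i: "i < n" by simp
    have "(?A *\<^sub>v v) $ i = (\<Sum>k<n. ?A $$ (i, k) * cos (real k * \<theta>))"
      using A i by (simp add: scalar_prod_def atLeast0LessThan v_def)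
    also have "\<dots> = a * cos (real i * \<theta>) + b * cos (real (i + 1) * \<theta>)
        + b * cos (real (i + (n - 1)) * \<theta>)"
      by (simp only: circ_tridiagonal_row_sum[OF n i] cos_mod)
    also have "cos (real (i + (n - 1)) * \<theta>) = cos (real i * \<theta> - \<theta>)"
    proof -
      have "real (i + (n - 1)) * \<theta> = (real i * \<theta> - \<theta>) + 2 * real j * pi"
        using n0 n\<theta> by (simp add: of_nat_diff algebra_simps)
      then show ?thesis by (simp only: cos_add cos_2npi sin_2npi mult_1_right mult_zero_right diff_zero)
    qed
    also have "a * cos (real i * \<theta>) + b * cos (real (i + 1) * \<theta>) + b * cos (real i * \<theta> - \<theta>)
        = (a + 2 * b * cos \<theta>) * cos (real i * \<theta>)"
      by (simp add: cos_add cos_diff algebra_simps)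
    finally show "(?A *\<^sub>v v) $ i = 0\<^sub>v n $ i" using j i by (simp add: \<theta>_def)
  qed (use A in auto)
  assume "invertible_mat ?A"
  then obtain B where AB: "?A * B = 1\<^sub>m n" and BA: "B * ?A = 1\<^sub>m (dim_row B)"
    using A by (auto simp: invertible_mat_def inverts_mat_def)
  have B: "B \<in> carrier_mat n n"
    using arg_cong[OF AB, of dim_col] arg_cong[OF BA, of dim_col] A by auto
  have v: "v \<in> carrier_vec n" by (simp add: v_def)
  have "v = (B * ?A) *\<^sub>v v" unfolding BA using B v by simp
  also have "\<dots> = B *\<^sub>v (?A *\<^sub>v v)" by (rule assoc_mult_mat_vec[OF B A v])
  also have "\<dots> = 0\<^sub>v n" unfolding Av using B by auto
  finally have "v = 0\<^sub>v n" .
  then have "v $ 0 = 0" using n0 by simp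
  then show False using n0 by (simp add: v_def)
qed

section \<open>Chebyshev polynomials\<close>

lemma second_order_recurrence_unique:
  fixes f g :: "nat \<Rightarrow> 'a :: comm_ring_1"
  assumes "\<And>m. f (m + 2) = c * f (m + 1) - f m" "\<And>m. g (m + 2) = c * g (m + 1) - g m"
    and "f 0 = g 0" "f 1 = g 1"
  shows "f m = g m"
proof (induction m rule: induct_nat_012)
  case (ge2 m)
  then show ?case using assms(1)[of m] assms(2)[of m] by simp
qed (use assms in auto)

lemma poly_cheb_T_rec:
  "poly (cheb_T (m + 1)) x = 2 * x * poly (cheb_T m) x - poly (cheb_T (m - 1)) x"
  by (simp add: cheb_T_rec)

lemma poly_cheb_U_rec:
  "poly (cheb_U (m + 1)) x = 2 * x * poly (cheb_U m) x - poly (cheb_U (m - 1)) x"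
  by (simp add: cheb_U_rec)

lemma cheb_T_cos: "poly (cheb_T (int m)) (cos t) = cos (real m * t)"
proof (rule second_order_recurrence_unique[where c = "2 * cos t"])
  fix m
  show "poly (cheb_T (int (m + 2))) (cos t)
      = 2 * cos t * poly (cheb_T (int (m + 1))) (cos t) - poly (cheb_T (int m)) (cos t)"
    using poly_cheb_T_rec[of "int m + 1" "cos t"] by (simp add: algebra_simps)
  have "real (m + 2) * t = real (m + 1) * t + t" "real m * t = real (m + 1) * t - t"
    by (simp_all add: algebra_simps)
  then show "cos (real (m + 2) * t) = 2 * cos t * cos (real (m + 1) * t) - cos (real m * t)"
    by (simp only: cos_add cos_diff) (simp add: algebra_simps)
qed (simp_all add: cheb_initial)

text \<open>Both sides satisfy the Chebyshev recurrence, and they agree for \<open>m = 0\<close> because \<open>U (- 2) = - 1\<close>.\<close>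

lemma cheb_U_diff: "poly (cheb_U (int m)) x - poly (cheb_U (int m - 2)) x = 2 * poly (cheb_T (int m)) x"
proof (rule second_order_recurrence_unique[where c = "2 * x"])
  fix m
  show "2 * poly (cheb_T (int (m + 2))) x
      = 2 * x * (2 * poly (cheb_T (int (m + 1))) x) - 2 * poly (cheb_T (int m)) x"
    using poly_cheb_T_rec[of "int m + 1" x] by (simp add: algebra_simps)
  show "poly (cheb_U (int (m + 2))) x - poly (cheb_U (int (m + 2) - 2)) x
      = 2 * x * (poly (cheb_U (int (m + 1))) x - poly (cheb_U (int (m + 1) - 2)) x)
        - (poly (cheb_U (int m)) x - poly (cheb_U (int m - 2)) x)"
    using poly_cheb_U_rec[of "int m + 1" x] poly_cheb_U_rec[of "int m - 1" x]
    by (simp add: algebra_simps)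
next
  show "poly (cheb_U (int 0)) x - poly (cheb_U (int 0 - 2)) x = 2 * poly (cheb_T (int 0)) x"
    using poly_cheb_U_rec[of "- 1" x] by (simp add: cheb_initial)
qed (simp add: cheb_initial)

text \<open>The recurrence gives \<open>\<bar>T\<^bsub>m+2\<^esub>\<bar> \<ge> 2 \<bar>x\<bar> \<bar>T\<^bsub>m+1\<^esub>\<bar> - \<bar>T\<^sub>m\<bar> > \<bar>T\<^bsub>m+1\<^esub>\<bar>\<close> as soon as \<open>\<bar>T\<^sub>m\<bar> < \<bar>T\<^bsub>m+1\<^esub>\<bar>\<close>.
  Absolute values treat \<open>x > 1\<close> and \<open>x < - 1\<close> together.\<close>

lemma cheb_T_abs_strict_increasing:
  assumes x: "\<bar>x\<bar> > 1"
  shows "\<bar>poly (cheb_T (int m)) x\<bar> < \<bar>poly (cheb_T (int (Suc m))) x\<bar>"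
proof (induction m)
  case 0
  then show ?case using x by (simp add: cheb_initial)
next
  case (Suc m)
  let ?T = "\<lambda>k. poly (cheb_T (int k)) x"
  have "?T (Suc (Suc m)) = 2 * x * ?T (Suc m) - ?T m"
    using poly_cheb_T_rec[of "int m + 1" x] by (simp add: algebra_simps)
  then have "\<bar>?T (Suc (Suc m))\<bar> \<ge> 2 * (\<bar>x\<bar> * \<bar>?T (Suc m)\<bar>) - \<bar>?T m\<bar>"
    using abs_triangle_ineq2[of "2 * x * ?T (Suc m)" "?T m"] by (simp add: abs_mult)
  moreover have "\<bar>x\<bar> * \<bar>?T (Suc m)\<bar> \<ge> 1 * \<bar>?T (Suc m)\<bar>"
    using x by (intro mult_right_mono) auto
  ultimately show ?case using Suc by linarith
qed

lemma cheb_T_abs_gt_one: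
  assumes "\<bar>x\<bar> > 1" "m > 0"
  shows "\<bar>poly (cheb_T (int m)) x\<bar> > 1"
proof -
  have "\<bar>poly (cheb_T (int 0)) x\<bar> < \<bar>poly (cheb_T (int m)) x\<bar>"
    by (rule lift_Suc_mono_less[OF _ assms(2), where f = "\<lambda>m. \<bar>poly (cheb_T (int m)) x\<bar>"])
       (rule cheb_T_abs_strict_increasing[OF assms(1)])
  then show ?thesis by (simp add: cheb_initial)
qed

text \<open>Such an \<open>x\<close> lies in \<open>[- 1, 1]\<close>, so \<open>x = - cos t = cos (\<pi> - t)\<close> with \<open>0 \<le> t \<le> \<pi>\<close>, and
  \<open>T\<^sub>n(x) = cos (n \<pi> - n t) = (- 1)\<^sup>n cos (n t)\<close>. Hence \<open>n t\<close> is a multiple \<open>2 \<pi> j\<close>, and \<open>t \<le> \<pi>\<close> bounds \<open>j\<close>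
  by \<open>n / 2\<close>: half of the \<open>n\<close>-th roots of unity suffice, as conjugate ones have the same cosine.\<close>

lemma cheb_T_eq_sign_imp:
  assumes n: "n > 0" and T: "poly (cheb_T (int n)) x = (- 1) ^ n"
  shows "\<exists>j. 2 * j \<le> n \<and> x + cos (2 * pi * real j / real n) = 0"
proof -
  have "\<bar>x\<bar> \<le> 1" using cheb_T_abs_gt_one[of x n] n T by (force simp: power_abs)
  define t where "t = arccos (- x)"
  have t: "0 \<le> t" "t \<le> pi" "x = - cos t" using \<open>\<bar>x\<bar> \<le> 1\<close> by (auto simp: t_def arccos_lbound arccos_ubound)
  have "x = cos (pi - t)" using t by simp
  then have "cos (real n * (pi - t)) = (- 1) ^ n" using T by (simp only: cheb_T_cos)
  moreover have "real n * (pi - t) = real n * pi - real n * t" by (simp add: algebra_simps)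
  ultimately have "(- 1) ^ n * cos (real n * t) = (- 1) ^ n"
    by (simp add: cos_diff)
  then have "cos (real n * t) = 1" by simp
  then obtain k :: nat where "real n * t = real k * 2 * pi \<or> real n * t = - (real k * 2 * pi)"
    using cos_one_2pi by blast
  moreover have "real n * t \<ge> 0" "real k * 2 * pi \<ge> 0" using t by auto
  ultimately have k: "real n * t = real k * 2 * pi" by linarith
  have "real k * 2 * pi \<le> real n * pi" unfolding k[symmetric] using t by (simp add: mult_left_mono)
  then have "2 * k \<le> n" by (simp add: algebra_simps)
  moreover have "t = 2 * pi * real k / real n" using k n by (simp add: field_simps)
  ultimately show ?thesis using t by auto
qed

section \<open>The inverse as a periodic Green's function\<close>

text \<open>The entries \<open>g\<^sub>j\<close> of the inverse as a function of \<open>x = a / (2 b)\<close>. All \<open>j\<close> are admitted: the values at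
  \<open>0\<close> and \<open>n + 1\<close> continue the recurrence one step beyond both ends of \<open>1, \<dots>, n\<close>.\<close>

definition cheb_green :: "nat \<Rightarrow> real \<Rightarrow> real \<Rightarrow> nat \<Rightarrow> real" where
  "cheb_green n b x j = (- 1) ^ j / (2 * b * (1 - (- 1) ^ n * poly (cheb_T (int n)) x))
     * (poly (cheb_U (int j - 2)) x + (- 1) ^ n * poly (cheb_U (int n - int j)) x)"

text \<open>Both \<open>U (j - 2)\<close> and its reflection \<open>U (n - j)\<close> satisfy the Chebyshev recurrence in \<open>j\<close>, which is
  symmetric under reversal; the factor \<open>(- 1) ^ j\<close> changes the sign of its middle term.\<close>

lemma cheb_green_rec:
  "cheb_green n b x j + 2 * x * cheb_green n b x (j + 1) + cheb_green n b x (j + 2) = 0"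
proof -
  have 1: "poly (cheb_U (int j)) x = 2 * x * poly (cheb_U (int j - 1)) x - poly (cheb_U (int j - 2)) x"
    using poly_cheb_U_rec[of "int j - 1" x] by simp
  have 2: "poly (cheb_U (int n - int j)) x
     = 2 * x * poly (cheb_U (int n - int j - 1)) x - poly (cheb_U (int n - int j - 2)) x"
    using poly_cheb_U_rec[of "int n - int j - 1" x] by simp
  have 3: "int (j + 1) - 2 = int j - 1" "int (j + 2) - 2 = int j"
     "int n - int (j + 1) = int n - int j - 1" "int n - int (j + 2) = int n - int j - 2" by auto
  define C where "C = (- 1) ^ j / (2 * b * (1 - (- 1) ^ n * poly (cheb_T (int n)) x))"
  define s :: real where "s = (- 1) ^ n"
  have "cheb_green n b x j = C * (poly (cheb_U (int j - 2)) x + s * poly (cheb_U (int n - int j)) x)"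
    "cheb_green n b x (j + 1) = - C * (poly (cheb_U (int j - 1)) x + s * poly (cheb_U (int n - int j - 1)) x)"
    "cheb_green n b x (j + 2) = C * (poly (cheb_U (int j)) x + s * poly (cheb_U (int n - int j - 2)) x)"
    unfolding cheb_green_def 3 by (simp_all add: C_def s_def)
  then show ?thesis unfolding 1 2 by (simp only:) (simp add: algebra_simps)
qed

lemma cheb_green_periodic: "cheb_green n b x (n + 1) = cheb_green n b x 1"
proof -
  have "int (n + 1) - 2 = int n - 1" "int n - int (n + 1) = - 1" by auto
  then show ?thesis by (simp add: cheb_green_def cheb_initial)
qed

text \<open>Since \<open>U (- 2) = - 1\<close> and \<open>U 0 = 1\<close>, the numerators of the two values differ by
  \<open>2 - (- 1) ^ n * (U n - U (n - 2)) = 2 * (1 - (- 1) ^ n * T n)\<close>: the normalising denominator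
  is chosen to cancel this.\<close>

lemma cheb_green_jump:
  assumes "b \<noteq> 0" "poly (cheb_T (int n)) x \<noteq> (- 1) ^ n"
  shows "b * (cheb_green n b x n - cheb_green n b x 0) = 1"
proof -
  define s :: real where "s = (- 1) ^ n"
  have ss: "s * s = 1" by (simp add: s_def flip: power_mult_distrib)
  let ?T = "poly (cheb_T (int n)) x"
  have D: "1 - s * ?T \<noteq> 0" using assms(2) ss unfolding s_def[symmetric]
    by (metis eq_iff_diff_eq_0 mult.assoc mult_1)
  have U: "poly (cheb_U (- 2)) x = - 1" using poly_cheb_U_rec[of "- 1" x] by (simp add: cheb_initial)
  have "cheb_green n b x n - cheb_green n b x 0
      = (s * (poly (cheb_U (int n - 2)) x + s) - (s * poly (cheb_U (int n)) x - 1)) / (2 * b * (1 - s * ?T))"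
    by (simp add: cheb_green_def s_def[symmetric] cheb_initial U diff_divide_distrib)
  also have "s * (poly (cheb_U (int n - 2)) x + s) - (s * poly (cheb_U (int n)) x - 1)
     = s * s + 1 - s * (poly (cheb_U (int n)) x - poly (cheb_U (int n - 2)) x)" 
    by (simp add: algebra_simps)
  also have "\<dots> = 2 * (1 - s * ?T)" unfolding cheb_U_diff ss by (simp add: algebra_simps)
  also have "\<dots> / (2 * b * (1 - s * ?T)) = 1 / b" using D assms(1) by (simp add: divide_simps)
  finally show ?thesis using assms(1) by simp
qed

theorem corollary3p7:
  fixes n :: nat and a b :: real
  assumes "n \<ge> 3" and "b \<noteq> 0"
  defines "A \<equiv> circ ([a, b] @ replicate (n - 3) 0 @ [b])"
    and "g \<equiv> \<lambda>j::nat. (- 1) ^ j / (2 * b * (1 - (- 1) ^ n * poly (cheb_T (int n)) (a / (2 * b))))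
               * (poly (cheb_U (int j - 2)) (a / (2 * b))
                  + (- 1) ^ n * poly (cheb_U (int n - int j)) (a / (2 * b)))"
  shows "(invertible_mat A \<longleftrightarrow>
            (\<Prod>j = 0..nat \<lceil>(real n - 1) / 2\<rceil>. a + 2 * b * cos (2 * pi * real j / real n)) \<noteq> 0)
         \<and> (invertible_mat A \<longrightarrow>
            inverts_mat A (circ (map g [1..<Suc n])) \<and> inverts_mat (circ (map g [1..<Suc n])) A)"
proof -
  let ?G = "circ (map g [1..<Suc n])"
  let ?P = "\<Prod>j = 0..nat \<lceil>(real n - 1) / 2\<rceil>. a + 2 * b * cos (2 * pi * real j / real n)"
  define x where "x = a / (2 * b)"
  have ax: "a = b * (2 * x)" using assms(2) by (simp add: x_def)
  have g: "g = cheb_green n b x" unfolding g_def cheb_green_def x_def ..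
  have "length ([a, b] @ replicate (n - 3) 0 @ [b]) = n" using assms(1) by simp
  then have A: "A \<in> carrier_mat n n" unfolding A_def by (metis circ_carrier)
  have G: "?G \<in> carrier_mat n n" using circ_carrier[of "map g [1..<Suc n]"] by (simp del: upt_Suc)
  have singular: "\<not> invertible_mat A" if "?P = 0"
    using that circ_tridiagonal_kernel[OF assms(1)] by (auto simp: A_def)
  have inverse: "inverts_mat A ?G \<and> inverts_mat ?G A" if P: "?P \<noteq> 0"
  proof -
    \<comment> \<open>Otherwise one of the factors of the product would be zero.\<close>
    have T: "poly (cheb_T (int n)) x \<noteq> (- 1) ^ n"
    proof
      assume "poly (cheb_T (int n)) x = (- 1) ^ n"
      then obtain j where j: "2 * j \<le> n" "x + cos (2 * pi * real j / real n) = 0"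
        using cheb_T_eq_sign_imp[of n x] assms(1) by auto
      \<comment> \<open>The upper limit of the product is \<open>\<lfloor>n / 2\<rfloor>\<close>.\<close>
      have "j \<le> nat \<lceil>(real n - 1) / 2\<rceil>"
      proof -
        have "2 * real j \<le> real n" using of_nat_mono[OF j(1)] by simp
        then have "real j - 1 < (real n - 1) / 2" by simp
        then have "int j \<le> \<lceil>(real n - 1) / 2\<rceil>" by linarith
        then show ?thesis by linarith
      qed
      moreover have "a + 2 * b * cos (2 * pi * real j / real n) = 2 * b * (x + cos (2 * pi * real j / real n))"
        by (simp add: ax algebra_simps)
      then have "a + 2 * b * cos (2 * pi * real j / real n) = 0" using j(2) by simp
      ultimately show False using P by (auto intro: prod_zero)
    qed
    have "A * ?G = 1\<^sub>m n" unfolding A_def g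
    proof (rule circ_tridiagonal_mult_eq_one[OF assms(1) _ cheb_green_periodic cheb_green_jump[OF assms(2) T]])
      fix j
      show "b * cheb_green n b x j + a * cheb_green n b x (j + 1) + b * cheb_green n b x (j + 2) = 0"
        using arg_cong[OF cheb_green_rec[of n b x j], of "\<lambda>y. b * y"]
        unfolding ax by (simp add: algebra_simps)
    qed
    moreover from this have "?G * A = 1\<^sub>m n" by (rule mat_mult_left_right_inverse[OF A G])
    ultimately show ?thesis using A G by (simp add: inverts_mat_def)
  qed
  have "invertible_mat A" if "?P \<noteq> 0"
    using inverse[OF that] A by (auto simp: invertible_mat_def)
  with singular inverse show ?thesis by blast
qed

end
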